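(* Let $N>2$ and $q\ge 2$ be integers, and let $P$ be the first eigenmatrix of the Hamming scheme $H(N,q)$, i.e. the $(N+1)\times(N+1)$ matrix with $(i,j)$ entry $P_j(i)=K_j(i)=\sum_{l=0}^{j}(-1)^l(q-1)^{j-l}\binom{i}{l}\binom{N-i}{j-l}$ for $0\le i,j\le N$. Then the diagonal complex matrices $T=\mathrm{diag}(T_0,\dots,T_N)$ with $(PT)^3=I$ are exactly those with $T_i=c\,x^i$ for $0\le i\le N$, where $x$ satisfies $1-2x+qx+x^2=0$ and $c$ satisfies $c^3\bigl(q(1+(q-1)x)\bigr)^N=1$.
   Context: The Hamming scheme $H(N,q)$ has point set $F^N$ for an alphabet $F$ of size $q$, with $(u,v)\in R_i$ iff $u,v$ differ in exactly $i$ coordinates ($0\le i\le N$). It is a self-dual P-polynomial association scheme, and with the idempotents in their standard (self-dual) order its first eigenmatrix is given by the Krawtchouk polynomials as stated; in particular $P_1(i)=N(q-1)-qi$. $PT$ denotes the matrix with $(i,j)$ entry $P_j(i)T_j$. *)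

theory Defs
  imports
    Complex_Main
    "HOL-Computational_Algebra.Polynomial"
    "Jordan_Normal_Form.Matrix"
begin

section \<open>The Hamming scheme and its first eigenmatrix\<close>

definition words :: "'a set \<Rightarrow> nat \<Rightarrow> 'a list set" where
  "words F N = {u. set u \<subseteq> F \<and> length u = N}"

definition hamming_dist :: "'a list \<Rightarrow> 'a list \<Rightarrow> nat" where
  "hamming_dist u v = card {k. k < length u \<and> u ! k \<noteq> v ! k}"

definition hamming_rel :: "'a set \<Rightarrow> nat \<Rightarrow> nat \<Rightarrow> ('a list \<times> 'a list) set" where
  "hamming_rel F N i = {(u, v) \<in> words F N \<times> words F N. hamming_dist u v = i}"

text \<open>
  \<open>first_eigenmatrix X R d P\<close>: there are \<open>d + 1\<close> nonzero, pairwise orthogonal idempotents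
  \<open>E\<^sub>0, \<dots>, E\<^sub>d\<close> (written as \<open>X \<times> X\<close> kernels) in the span of the adjacency matrices
  \<open>A\<^sub>0, \<dots>, A\<^sub>d\<close> of the relations \<open>R\<^sub>0, \<dots>, R\<^sub>d\<close>, with \<open>E\<^sub>0 = |X|\<^sup>-\<^sup>1 J\<close>, and the columns of \<open>P\<close>
  are the eigenvalues: \<open>A\<^sub>j = \<Sum>\<^sub>i P\<^sub>i\<^sub>j E\<^sub>i\<close>.  As that span is a commutative algebra of
  dimension \<open>d + 1\<close>, the \<open>E\<^sub>i\<close> are exactly its primitive idempotents.  Their order, apart from
  \<open>E\<^sub>0\<close>, is not fixed by this predicate.
\<close>

definition first_eigenmatrix ::
    "'x set \<Rightarrow> (nat \<Rightarrow> ('x \<times> 'x) set) \<Rightarrow> nat \<Rightarrow> complex mat \<Rightarrow> bool" where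
  "first_eigenmatrix X R d P \<longleftrightarrow> P \<in> carrier_mat (d + 1) (d + 1) \<and>
    (\<exists>E :: nat \<Rightarrow> 'x \<Rightarrow> 'x \<Rightarrow> complex.
      (\<forall>i\<le>d. \<exists>c. \<forall>u\<in>X. \<forall>v\<in>X. E i u v = (\<Sum>j\<le>d. c j * of_bool ((u, v) \<in> R j))) \<and>
      (\<forall>i\<le>d. \<exists>u\<in>X. \<exists>v\<in>X. E i u v \<noteq> 0) \<and>
      (\<forall>i\<le>d. \<forall>j\<le>d. \<forall>u\<in>X. \<forall>v\<in>X.
        (\<Sum>w\<in>X. E i u w * E j w v) = (if i = j then E i u v else 0)) \<and>
      (\<forall>u\<in>X. \<forall>v\<in>X. E 0 u v = 1 / of_nat (card X)) \<and>
      (\<forall>j\<le>d. \<forall>u\<in>X. \<forall>v\<in>X. of_bool ((u, v) \<in> R j) = (\<Sum>i\<le>d. P $$ (i, j) * E i u v)))"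

definition krawtchouk :: "nat \<Rightarrow> nat \<Rightarrow> nat \<Rightarrow> nat \<Rightarrow> complex" where
  "krawtchouk N q j i = (\<Sum>l\<le>j. (- 1) ^ l * (of_nat q - 1) ^ (j - l) *
     of_nat (i choose l) * of_nat ((N - i) choose (j - l)))"

definition hamming_eigenmatrix :: "nat \<Rightarrow> nat \<Rightarrow> complex mat" where
  "hamming_eigenmatrix N q = mat (N + 1) (N + 1) (\<lambda>(i, j). krawtchouk N q j i)"


subsection \<open>The Krawtchouk matrix is the first eigenmatrix of the Hamming scheme\<close>

definition kraw_gen :: "nat \<Rightarrow> nat \<Rightarrow> nat \<Rightarrow> complex poly" where
  "kraw_gen N q d = [:1, of_nat q - 1:] ^ (N - d) * [:1, - 1:] ^ d"

lemma coeff_linear_power1: "coeff ([:1, a:] ^ n) k = of_nat (n choose k) * (a :: complex) ^ k"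
proof (induction n arbitrary: k)
  case 0
  then show ?case by (cases k) auto
next
  case (Suc n)
  then show ?case by (cases k) (auto simp: algebra_simps)
qed

lemma coeff_kraw_gen: "coeff (kraw_gen N q d) j = krawtchouk N q j d"
  unfolding kraw_gen_def krawtchouk_def
  by (subst mult.commute, simp add: coeff_mult coeff_linear_power1 mult_ac)

lemma degree_linear_power1_le: "degree ([:1, a :: complex:] ^ n) \<le> n"
  by (metis coeff_linear_power1 degree_le binomial_eq_0 of_nat_0 mult_zero_left)

lemma degree_kraw_gen:
  assumes "d \<le> N" shows "degree (kraw_gen N q d) \<le> N"
proof -
  have "degree (kraw_gen N q d) \<le> (N - d) + d"
    unfolding kraw_gen_def
    by (intro order.trans[OF degree_mult_le] add_mono degree_linear_power1_le)
  then show ?thesis using assms by simp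
qed

lemma poly_kraw_gen:
  "poly (kraw_gen N q d) z = (1 + (of_nat q - 1) * z) ^ (N - d) * (1 - z) ^ d"
  by (simp add: kraw_gen_def poly_power mult_ac)

lemma poly_kraw_gen_sum:
  assumes "d \<le> N"
  shows "poly (kraw_gen N q d) z = (\<Sum>i\<le>N. krawtchouk N q i d * z ^ i)"
proof -
  have "poly (kraw_gen N q d) z = (\<Sum>i\<le>N. coeff (kraw_gen N q d) i * z ^ i)"
    unfolding poly_altdef using degree_kraw_gen[OF assms]
    by (intro sum.mono_neutral_left) (auto simp: coeff_eq_0)
  then show ?thesis by (simp add: coeff_kraw_gen)
qed

lemma hamming_dist_Cons:
  "hamming_dist (a # u) (b # v) = of_bool (a \<noteq> b) + hamming_dist u v"
proof -
  have "{k. k < length (a # u) \<and> (a # u) ! k \<noteq> (b # v) ! k} =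
      (if a \<noteq> b then {0} else {}) \<union> Suc ` {k. k < length u \<and> u ! k \<noteq> v ! k}"
    by (auto simp: image_iff less_Suc_eq_0_disj nth_Cons')
  moreover have "0 \<notin> Suc ` {k. k < length u \<and> u ! k \<noteq> v ! k}" by auto
  ultimately show ?thesis
    by (auto simp: hamming_dist_def card_image)
qed

lemma hamming_dist_le: "hamming_dist u v \<le> length u"
proof -
  have "card {k. k < length u \<and> u ! k \<noteq> v ! k} \<le> card {..<length u}"
    by (intro card_mono) auto
  then show ?thesis by (simp add: hamming_dist_def)
qed

lemma hamming_dist_self [simp]: "hamming_dist u u = 0"
  by (simp add: hamming_dist_def)

lemma finite_words: "finite F \<Longrightarrow> finite (words F N)"
  unfolding words_def by (rule finite_lists_length_eq)

lemma card_words: "finite F \<Longrightarrow> card (words F N) = card F ^ N"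
  unfolding words_def by (rule card_lists_length_eq)

lemma words_Suc: "words F (Suc N) = (\<lambda>(a, u). a # u) ` (F \<times> words F N)"
  by (auto simp: words_def image_iff length_Suc_conv)

lemma sum_words_Suc: "(\<Sum>w\<in>words F (Suc N). f w) = (\<Sum>a\<in>F. \<Sum>w\<in>words F N. f (a # w))"
  unfolding words_Suc by (subst sum.reindex) (auto simp: inj_on_def sum.cartesian_product split_def)

definition letter_gen :: "nat \<Rightarrow> complex \<Rightarrow> 'a \<Rightarrow> 'a \<Rightarrow> complex" where
  "letter_gen q z a b = 1 - z + of_nat q * z * of_bool (a = b)"

lemma poly_kraw_gen_Cons:
  assumes "length u = N"
  shows "poly (kraw_gen (Suc N) q (hamming_dist (a # u) (b # v))) z =
    letter_gen q z a b * poly (kraw_gen N q (hamming_dist u v)) z"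
proof -
  have "hamming_dist u v \<le> N" using hamming_dist_le assms by blast
  then show ?thesis
    by (auto simp: poly_kraw_gen hamming_dist_Cons letter_gen_def Suc_diff_le algebra_simps)
qed

lemma letter_gen_conv:
  assumes F: "finite F" "card F = q" and ab: "a \<in> F" "b \<in> F"
  shows "(\<Sum>c\<in>F. letter_gen q y a c * letter_gen q z c b) = of_nat q * letter_gen q (y * z) a b"
proof -
  have "(\<Sum>c\<in>F. letter_gen q y a c * letter_gen q z c b) =
      (\<Sum>c\<in>F. (1 - y) * (1 - z) + (if a = c then of_nat q * y * (1 - z) else 0)
        + (if c = b then (1 - y) * of_nat q * z else 0)
        + (if a = c then of_nat q * y * (of_nat q * z * of_bool (a = b)) else 0))"
    by (rule sum.cong) (auto simp: letter_gen_def algebra_simps)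
  also have "\<dots> = of_nat q * ((1 - y) * (1 - z)) + of_nat q * y * (1 - z)
        + (1 - y) * of_nat q * z + of_nat q * y * (of_nat q * z * of_bool (a = b))"
    using F ab by (simp add: sum.distrib)
  also have "\<dots> = of_nat q * letter_gen q (y * z) a b"
    by (simp add: letter_gen_def algebra_simps)
  finally show ?thesis .
qed

lemma poly_kraw_gen_conv:
  assumes F: "finite F" "card F = q"
  shows "u \<in> words F N \<Longrightarrow> v \<in> words F N \<Longrightarrow>
    (\<Sum>w\<in>words F N. poly (kraw_gen N q (hamming_dist u w)) y *
        poly (kraw_gen N q (hamming_dist w v)) z) =
      of_nat q ^ N * poly (kraw_gen N q (hamming_dist u v)) (y * z)"
proof (induction N arbitrary: u v)
  case 0
  have "words F 0 = {[]}" by (auto simp: words_def)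
  then show ?case using 0 by (simp add: kraw_gen_def)
next
  case (Suc N)
  obtain a u' where u: "u = a # u'" "a \<in> F" "u' \<in> words F N"
    using Suc.prems(1) by (auto simp: words_Suc)
  obtain b v' where v: "v = b # v'" "b \<in> F" "v' \<in> words F N"
    using Suc.prems(2) by (auto simp: words_Suc)
  have len: "length w = N" if "w \<in> words F N" for w using that by (simp add: words_def)
  have "(\<Sum>w\<in>words F (Suc N). poly (kraw_gen (Suc N) q (hamming_dist u w)) y *
        poly (kraw_gen (Suc N) q (hamming_dist w v)) z) =
      (\<Sum>c\<in>F. \<Sum>w\<in>words F N. (letter_gen q y a c * letter_gen q z c b) *
        (poly (kraw_gen N q (hamming_dist u' w)) y * poly (kraw_gen N q (hamming_dist w v')) z))"
    unfolding sum_words_Suc u(1) v(1)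
    by (intro sum.cong refl) (simp add: poly_kraw_gen_Cons len u(3) mult_ac)
  also have "\<dots> = of_nat q * letter_gen q (y * z) a b *
      (of_nat q ^ N * poly (kraw_gen N q (hamming_dist u' v')) (y * z))"
    by (simp add: sum_distrib_left[symmetric] sum_distrib_right[symmetric]
        Suc.IH[OF u(3) v(3)] letter_gen_conv[OF F u(2) v(2)])
  finally show ?case
    by (simp add: u(1) v(1) poly_kraw_gen_Cons len u(3) mult_ac)
qed

lemma krawtchouk_conv:
  assumes F: "finite F" "card F = q" and uv: "u \<in> words F N" "v \<in> words F N"
    and ij: "i \<le> N" "j \<le> N"
  shows "(\<Sum>w\<in>words F N. krawtchouk N q i (hamming_dist u w) * krawtchouk N q j (hamming_dist w v))
    = (if i = j then of_nat q ^ N * krawtchouk N q i (hamming_dist u v) else 0)"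
proof -
  have dle: "hamming_dist x y \<le> N" if "x \<in> words F N" for x y
    using that hamming_dist_le[of x y] by (simp add: words_def)
  define S where "S i j = (\<Sum>w\<in>words F N. krawtchouk N q i (hamming_dist u w) *
    krawtchouk N q j (hamming_dist w v))" for i j
  define D where "D i j = (if i = j then of_nat q ^ N * krawtchouk N q i (hamming_dist u v) else 0)"
    for i j
  have eq: "(\<Sum>i\<le>N. (\<Sum>j\<le>N. S i j * z ^ j) * y ^ i) = (\<Sum>i\<le>N. (\<Sum>j\<le>N. D i j * z ^ j) * y ^ i)"
    for y z
  proof -
    have "(\<Sum>i\<le>N. (\<Sum>j\<le>N. S i j * z ^ j) * y ^ i) =
       (\<Sum>i\<le>N. \<Sum>j\<le>N. \<Sum>w\<in>words F N. krawtchouk N q i (hamming_dist u w) * y ^ i *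
          (krawtchouk N q j (hamming_dist w v) * z ^ j))"
      by (simp add: S_def sum_distrib_right sum_distrib_left mult_ac)
    also have "\<dots> = (\<Sum>i\<le>N. \<Sum>w\<in>words F N. \<Sum>j\<le>N. krawtchouk N q i (hamming_dist u w) * y ^ i *
          (krawtchouk N q j (hamming_dist w v) * z ^ j))"
      by (intro sum.cong refl sum.swap)
    also have "\<dots> = (\<Sum>w\<in>words F N. \<Sum>i\<le>N. \<Sum>j\<le>N. krawtchouk N q i (hamming_dist u w) * y ^ i *
          (krawtchouk N q j (hamming_dist w v) * z ^ j))"
      by (rule sum.swap)
    also have "\<dots> = (\<Sum>w\<in>words F N. poly (kraw_gen N q (hamming_dist u w)) y *
        poly (kraw_gen N q (hamming_dist w v)) z)"
      by (intro sum.cong refl) (simp add: poly_kraw_gen_sum dle uv sum_product)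
    also have "\<dots> = of_nat q ^ N * poly (kraw_gen N q (hamming_dist u v)) (y * z)"
      by (rule poly_kraw_gen_conv[OF F uv])
    also have "\<dots> = (\<Sum>i\<le>N. of_nat q ^ N * krawtchouk N q i (hamming_dist u v) * z ^ i * y ^ i)"
      by (simp add: poly_kraw_gen_sum dle uv sum_distrib_left power_mult_distrib mult_ac)
    also have "\<dots> = (\<Sum>i\<le>N. (\<Sum>j\<le>N. D i j * z ^ j) * y ^ i)"
      by (intro sum.cong refl) (simp add: D_def if_distrib[of "\<lambda>x. x * _"] cong: if_cong)
    finally show ?thesis .
  qed
  have "(\<Sum>j\<le>N. S i j * z ^ j) = (\<Sum>j\<le>N. D i j * z ^ j)" for z
    using eq[of z] polyfun_eq_coeffs[of "\<lambda>i. \<Sum>j\<le>N. S i j * z ^ j" N "\<lambda>i. \<Sum>j\<le>N. D i j * z ^ j"]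
      ij by blast
  then have "S i j = D i j"
    using polyfun_eq_coeffs[of "S i" N "D i"] ij by blast
  then show ?thesis by (simp add: S_def D_def)
qed

lemma krawtchouk_orthogonal:
  assumes "d \<le> N" "j \<le> N"
  shows "(\<Sum>i\<le>N. krawtchouk N q j i * krawtchouk N q i d) = (if j = d then of_nat q ^ N else 0)"
proof -
  define f :: "complex poly" where "f = (\<Sum>i\<le>N. Polynomial.smult (krawtchouk N q i d) (kraw_gen N q i))"
  define g :: "complex poly" where "g = monom (of_nat q ^ N) d"
  have "poly (f - g) z = 0" if nz: "1 + (of_nat q - 1) * z \<noteq> 0" for z
  proof -
    define a where "a = 1 + (of_nat q - 1) * z"
    define t where "t = (1 - z) / a"
    have a: "a \<noteq> 0" using nz by (simp add: a_def)
    have at: "a * t = 1 - z" using a by (simp add: t_def)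
    have "poly f z = (\<Sum>i\<le>N. krawtchouk N q i d * (a ^ (N - i) * (a * t) ^ i))"
      by (simp add: f_def poly_sum poly_kraw_gen a_def[symmetric] at)
    also have "\<dots> = (\<Sum>i\<le>N. a ^ N * (krawtchouk N q i d * t ^ i))"
    proof (intro sum.cong refl)
      fix i assume "i \<in> {..N}"
      then have "a ^ N = a ^ (N - i) * a ^ i" by (simp add: power_add[symmetric])
      then show "krawtchouk N q i d * (a ^ (N - i) * (a * t) ^ i)
          = a ^ N * (krawtchouk N q i d * t ^ i)"
        by (simp add: power_mult_distrib)
    qed
    also have "\<dots> = a ^ N * poly (kraw_gen N q d) t"
      by (simp add: poly_kraw_gen_sum assms sum_distrib_left)
    also have "\<dots> = a ^ (N - d) * a ^ d * ((1 + (of_nat q - 1) * t) ^ (N - d) * (1 - t) ^ d)"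
      using assms by (simp add: poly_kraw_gen power_add[symmetric])
    also have "\<dots> = (a * (1 + (of_nat q - 1) * t)) ^ (N - d) * (a * (1 - t)) ^ d"
      by (simp add: power_mult_distrib mult_ac)
    also have "a * (1 + (of_nat q - 1) * t) = a + (of_nat q - 1) * (a * t)"
      by (simp add: algebra_simps)
    also have "\<dots> = of_nat q" unfolding at by (simp add: a_def algebra_simps)
    also have "a * (1 - t) = a - a * t" by (simp add: algebra_simps)
    also have "\<dots> = of_nat q * z" unfolding at by (simp add: a_def algebra_simps)
    also have "of_nat q ^ (N - d) * (of_nat q * z) ^ d = of_nat q ^ N * z ^ d"
      using assms by (simp add: power_mult_distrib power_add[symmetric])
    finally show ?thesis by (simp add: g_def poly_monom)
  qed
  then have "poly (f - g) z * (1 + (of_nat q - 1) * z) = 0" for z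
    by (metis mult_eq_0_iff)
  then have "poly ((f - g) * [:1, of_nat q - 1:]) z = 0" for z
    by (simp only: poly_mult poly_pCons poly_0) (simp add: mult.commute)
  then have "(f - g) * [:1, of_nat q - 1:] = 0"
    using poly_all_0_iff_0 by blast
  then have "f - g = 0"
    by (metis mult_eq_0_iff pCons_eq_0_iff zero_neq_one)
  then have "coeff f j = coeff g j" by simp
  then show ?thesis
    by (auto simp: f_def g_def coeff_sum coeff_kraw_gen coeff_monom mult.commute)
qed

lemma krawtchouk_0 [simp]: "krawtchouk N q 0 d = 1"
  by (simp add: krawtchouk_def)

lemma krawtchouk_at_0: "krawtchouk N q j 0 = of_nat (N choose j) * (of_nat q - 1) ^ j"
  using coeff_kraw_gen[of N q 0 j] by (simp add: kraw_gen_def coeff_linear_power1)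

lemma krawtchouk_1:
  assumes "i \<le> N"
  shows "krawtchouk N q 1 i = of_nat N * (of_nat q - 1) - of_nat q * of_nat i"
  using assms by (simp add: krawtchouk_def of_nat_diff algebra_simps)

theorem hamming_first_eigenmatrix:
  assumes F: "finite F" "card F = q" and q: "q \<ge> 2"
  shows "first_eigenmatrix (words F N) (hamming_rel F N) N (hamming_eigenmatrix N q)"
    and "i \<le> N \<Longrightarrow> N \<ge> 1 \<Longrightarrow>
      hamming_eigenmatrix N q $$ (i, 1) = of_nat N * (of_nat q - 1) - of_nat q * of_nat i"
proof -
  let ?X = "words F N" and ?c = "of_nat q ^ N :: complex"
  define E where "E i u v = krawtchouk N q i (hamming_dist u v) / ?c" for i and u v :: "'a list"
  have q0: "?c \<noteq> 0" using q by simp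
  have dle: "hamming_dist x y \<le> N" if "x \<in> words F N" for x y :: "'a list"
    using that hamming_dist_le[of x y] by (simp add: words_def)
  have rel: "(u, v) \<in> hamming_rel F N j \<longleftrightarrow> hamming_dist u v = j" if "u \<in> ?X" "v \<in> ?X" for u v j
    using that by (simp add: hamming_rel_def)
  have "F \<noteq> {}" using F q by auto
  then obtain a where "a \<in> F" by blast
  then have w0: "replicate N a \<in> ?X" by (auto simp: words_def)
  have "\<exists>c. \<forall>u\<in>?X. \<forall>v\<in>?X. E i u v = (\<Sum>j\<le>N. c j * of_bool ((u, v) \<in> hamming_rel F N j))" for i
  proof (intro exI ballI)
    fix u v assume "u \<in> ?X" "v \<in> ?X"
    then show "E i u v = (\<Sum>j\<le>N. krawtchouk N q i j / ?c * of_bool ((u, v) \<in> hamming_rel F N j))"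
      by (simp add: rel E_def dle of_bool_def if_distrib[of "\<lambda>x. _ * x"] cong: if_cong)
  qed
  moreover have "\<exists>u\<in>?X. \<exists>v\<in>?X. E i u v \<noteq> 0" if "i \<le> N" for i
  proof (intro bexI[OF _ w0])
    have "of_nat q \<noteq> (1 :: complex)" using q by (simp add: of_nat_eq_1_iff)
    then show "E i (replicate N a) (replicate N a) \<noteq> 0"
      using that q0 q by (simp add: E_def krawtchouk_at_0)
  qed
  moreover have "(\<Sum>w\<in>?X. E i u w * E j w v) = (if i = j then E i u v else 0)"
    if "i \<le> N" "j \<le> N" "u \<in> ?X" "v \<in> ?X" for i j u v
  proof -
    have "(\<Sum>w\<in>?X. E i u w * E j w v) =
        (\<Sum>w\<in>?X. krawtchouk N q i (hamming_dist u w) * krawtchouk N q j (hamming_dist w v)) / (?c * ?c)"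
      by (simp add: E_def sum_divide_distrib)
    then show ?thesis
      using q0 by (simp add: krawtchouk_conv[OF F that(3,4,1,2)] E_def)
  qed
  moreover have "E 0 u v = 1 / of_nat (card ?X)" for u v
    using F by (simp add: E_def card_words)
  moreover have "of_bool ((u, v) \<in> hamming_rel F N j) =
      (\<Sum>i\<le>N. hamming_eigenmatrix N q $$ (i, j) * E i u v)"
    if "j \<le> N" "u \<in> ?X" "v \<in> ?X" for j u v
  proof -
    have "(\<Sum>i\<le>N. hamming_eigenmatrix N q $$ (i, j) * E i u v) =
        (\<Sum>i\<le>N. krawtchouk N q j i * krawtchouk N q i (hamming_dist u v)) / ?c"
      unfolding sum_divide_distrib using that
      by (intro sum.cong refl) (simp add: hamming_eigenmatrix_def E_def)
    then show ?thesis
      using q0 that by (auto simp: krawtchouk_orthogonal dle rel)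
  qed
  ultimately show "first_eigenmatrix ?X (hamming_rel F N) N (hamming_eigenmatrix N q)"
    unfolding first_eigenmatrix_def
    by (intro conjI exI[of _ E]) (auto simp: hamming_eigenmatrix_def)
  show "hamming_eigenmatrix N q $$ (i, 1) = of_nat N * (of_nat q - 1) - of_nat q * of_nat i"
    if "i \<le> N" "N \<ge> 1"
    using that krawtchouk_1[of i N q] by (simp add: hamming_eigenmatrix_def)
qed

end

theory Submission
  imports Defs
begin

text \<open>
  Let \<open>D\<close> be the diagonal matrix of the eigenvalues \<open>\<theta>\<^sub>i = N(q - 1) - qi\<close> and \<open>B\<close> the tridiagonal
  matrix of the difference equation of the Krawtchouk polynomials, so that \<open>BP = PD\<close>, \<open>PB = DP\<close> and
  \<open>P\<^sup>2 = q\<^sup>N I\<close>. If \<open>(PT)\<^sup>3 = I\<close>, then \<open>C = T\<^sup>-\<^sup>1BT\<close> and \<open>C' = TBT\<^sup>-\<^sup>1\<close> satisfy \<open>CP = PC'\<close>. The diagonal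
  of the tridiagonal matrix \<open>C'\<close> is affine in \<open>D\<close>, so \<open>[D, [D, C']] - q\<^sup>2C'\<close> is affine in \<open>D\<close>;
  conjugating by \<open>P\<close>, the matrix \<open>[B, [B, C]] - q\<^sup>2C\<close> is affine in \<open>B\<close>. Its entries at \<open>(0, 3)\<close> and
  \<open>(3, 0)\<close>, which exist as \<open>N > 2\<close>, say that both the three ratios \<open>T\<^sub>1/T\<^sub>0, T\<^sub>2/T\<^sub>1, T\<^sub>3/T\<^sub>2\<close> and their
  reciprocals are in arithmetic progression. Hence the ratios agree, and column \<open>0\<close> of \<open>CP = PC'\<close> is a
  recursion that yields the quadratic equation and \<open>T\<^sub>i = T\<^sub>0x\<^sup>i\<close>.

  Conversely, for \<open>X = diag(x\<^sup>i)\<close> with \<open>x\<close> a root of the quadratic, the generating function of the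
  Krawtchouk polynomials gives \<open>XPXPX = (1 + (q - 1)x)\<^sup>N P\<close>, which turns \<open>(PX)\<^sup>3\<close> into a multiple of
  \<open>P\<^sup>2\<close>.
\<close>

section \<open>Identities for Krawtchouk polynomials\<close>

text \<open>The operator N(q - 1) - q z d/dz multiplies z^j by the eigenvalue N(q - 1) - qj. Applied
  to the generating function (1 + (q-1)z)^(N-i) (1-z)^i, it produces the neighbours i - 1 and i + 1
  by the product rule. The boundary cases are harmless: the truncated i - 1 at i = 0 has coefficient
  i, and the index i + 1 at i = N has coefficient N - i.\<close>

lemma kraw_gen_ode:
  assumes "i \<le> N"
  shows "of_nat i * poly (kraw_gen N q (i - 1)) z + (of_nat q - 2) * of_nat i * poly (kraw_gen N q i) z +
      of_nat (N - i) * (of_nat q - 1) * poly (kraw_gen N q (Suc i)) z =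
    of_nat N * (of_nat q - 1) * poly (kraw_gen N q i) z - of_nat q * z * poly (pderiv (kraw_gen N q i)) z"
proof -
  obtain m where N: "N = m + i" using assms by (metis add.commute le_Suc_ex)
  define s where "s = (of_nat q :: complex)"
  define a where "a = 1 + (s - 1) * z"
  have lin: "poly (pderiv ([:1, c:] ^ n)) z = of_nat n * c * (1 + c * z) ^ (n - 1)" for c :: complex and n
    by (cases n) (simp_all add: pderiv_power_Suc pderiv_pCons poly_power mult_ac del: of_nat_Suc power_Suc)
  have d: "poly (pderiv (kraw_gen N q i)) z =
      of_nat m * (s - 1) * a ^ (m - 1) * (1 - z) ^ i - of_nat i * a ^ m * (1 - z) ^ (i - 1)"
    unfolding kraw_gen_def pderiv_mult poly_add poly_mult lin
    by (simp add: N poly_power a_def s_def mult_ac)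
  have lo: "of_nat i * poly (kraw_gen N q (i - 1)) z = of_nat i * (a * a ^ m * (1 - z) ^ (i - 1))"
    by (cases i) (simp_all add: N poly_kraw_gen a_def s_def mult_ac Suc_diff_le)
  have up: "of_nat (N - i) * (s - 1) * poly (kraw_gen N q (Suc i)) z =
      of_nat m * (s - 1) * (a ^ (m - 1) * ((1 - z) * (1 - z) ^ i))"
    by (cases m) (simp_all add: N poly_kraw_gen a_def s_def mult_ac)
  have mid: "poly (kraw_gen N q i) z = a ^ m * (1 - z) ^ i"
    by (simp add: N poly_kraw_gen a_def s_def)
  have im: "of_nat i * (1 - z) ^ i = of_nat i * ((1 - z) * (1 - z) ^ (i - 1))"
    by (cases i) simp_all
  have mm: "of_nat m * a ^ m = of_nat m * (a * a ^ (m - 1))"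
    by (cases m) simp_all
  \<comment> \<open>Here \<open>A\<close>, \<open>A'\<close> stand for a^m, a^(m-1),
    \<open>B\<close>, \<open>B'\<close> for (1-z)^i, (1-z)^(i-1), and \<open>w\<close> for 1 - z.
    The power laws carry the factors \<open>i\<close> and \<open>m\<close> so that they survive
    truncation of the exponents at 0.\<close>
  have "i * (a * A * B') + (s - 2) * i * (A * B) + m * (s - 1) * (A' * (w * B)) =
      (m + i) * (s - 1) * (A * B) - s * z * (m * (s - 1) * A' * B - i * A * B')"
    if "i * B = i * (w * B')" "m * A = m * (a * A')" "a = w + s * z"
    for i m a w A A' B B' :: complex
  proof -
    have "i * A * B' * a = A * (i * B) + i * A * B' * (s * z)"
      and "(s - 1) * (m * B * A' * w) = (s - 1) * (B * (m * A) - m * B * A' * (s * z))"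
      using that by (auto simp: algebra_simps)
    then show ?thesis by (simp add: algebra_simps)
  qed
  moreover have "a = 1 - z + s * z"
    by (simp add: a_def algebra_simps)
  moreover have "of_nat N = (of_nat m + of_nat i :: complex)"
    by (simp add: N)
  ultimately show ?thesis
    unfolding s_def[symmetric] d mid lo up using im mm by presburger
qed

text \<open>Comparison of the coefficients of z^j in \<open>kraw_gen_ode\<close>; the term z d/dz
  contributes the factor j.\<close>

lemma krawtchouk_difference:
  assumes i: "i \<le> N" and j: "j \<le> N"
  shows "of_nat i * krawtchouk N q j (i - 1) + (of_nat q - 2) * of_nat i * krawtchouk N q j i +
      of_nat (N - i) * (of_nat q - 1) * krawtchouk N q j (Suc i) =
    (of_nat N * (of_nat q - 1) - of_nat q * of_nat j) * krawtchouk N q j i"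
proof -
  let ?p = "Polynomial.smult (of_nat i) (kraw_gen N q (i - 1)) +
    Polynomial.smult ((of_nat q - 2) * of_nat i) (kraw_gen N q i) +
    Polynomial.smult (of_nat (N - i) * (of_nat q - 1)) (kraw_gen N q (Suc i))"
  let ?r = "Polynomial.smult (of_nat N * (of_nat q - 1)) (kraw_gen N q i) -
    Polynomial.smult (of_nat q) (pCons 0 (pderiv (kraw_gen N q i)))"
  have "poly ?p = poly ?r"
  proof
    fix z
    show "poly ?p z = poly ?r z"
      using kraw_gen_ode[OF i, of q z] by (simp add: mult_ac right_diff_distrib')
  qed
  then have "coeff ?p j = coeff ?r j" by (simp add: poly_eq_poly_eq_iff)
  then show ?thesis
    by (cases j) (simp_all add: coeff_kraw_gen coeff_pderiv algebra_simps)
qed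

section \<open>The homogeneous generating function and the twisted square of P\<close>

lemma krawtchouk_top:
  assumes "i \<le> N"
  shows "krawtchouk N q N i = (- 1) ^ i * (of_nat q - 1) ^ (N - i)"
proof -
  have "krawtchouk N q N i = (\<Sum>l\<in>{i}. (- 1) ^ l * (of_nat q - 1) ^ (N - l) *
     of_nat (i choose l) * of_nat ((N - i) choose (N - l)))"
    unfolding krawtchouk_def
  proof (intro sum.mono_neutral_right ballI)
    fix l assume "l \<in> {..N} - {i}"
    then have "i < l \<or> N - i < N - l" using assms by auto
    then show "(- 1) ^ l * (of_nat q - 1) ^ (N - l) * of_nat (i choose l) *
        of_nat ((N - i) choose (N - l)) = (0 :: complex)"
      by (auto simp: binomial_eq_0)
  qed (use assms in auto)
  then show ?thesis by simp
qed

text \<open>For a nonzero this is the generating function at b/a, scaled by a^N. For a = 0 only k =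
  N survives, hence the need for \<open>krawtchouk_top\<close>. The homogeneous form is what allows
  arbitrary z in the next proof, where a depends on z and may vanish.\<close>

lemma krawtchouk_homogeneous:
  assumes "i \<le> N"
  shows "(\<Sum>k\<le>N. krawtchouk N q k i * a ^ (N - k) * b ^ k) =
    (a + (of_nat q - 1) * b) ^ (N - i) * (a - b) ^ i"
proof (cases "a = 0")
  case True
  have "(\<Sum>k\<le>N. krawtchouk N q k i * a ^ (N - k) * b ^ k) =
      (\<Sum>k\<in>{N}. krawtchouk N q k i * a ^ (N - k) * b ^ k)"
    by (intro sum.mono_neutral_right) (use True in auto)
  also have "\<dots> = (- 1) ^ i * (of_nat q - 1) ^ (N - i) * (b ^ (N - i) * b ^ i)"
    using assms by (simp add: krawtchouk_top power_add[symmetric])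
  also have "\<dots> = ((of_nat q - 1) * b) ^ (N - i) * (- b) ^ i"
    by (simp add: power_mult_distrib power_minus[of b] mult_ac)
  finally show ?thesis using True by simp
next
  case False
  have "(\<Sum>k\<le>N. krawtchouk N q k i * a ^ (N - k) * b ^ k) =
      (\<Sum>k\<le>N. a ^ N * (krawtchouk N q k i * (b / a) ^ k))"
    by (intro sum.cong refl) (use False in \<open>simp add: power_diff power_divide\<close>)
  also have "\<dots> = a ^ (N - i) * a ^ i * ((1 + (of_nat q - 1) * (b / a)) ^ (N - i) * (1 - b / a) ^ i)"
    using assms
    by (simp add: sum_distrib_left[symmetric] poly_kraw_gen_sum[OF assms, symmetric] poly_kraw_gen
        power_add[symmetric])
  also have "\<dots> = (a * (1 + (of_nat q - 1) * (b / a))) ^ (N - i) * (a * (1 - b / a)) ^ i"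
    by (simp add: power_mult_distrib mult_ac)
  also have "\<dots> = (a + (of_nat q - 1) * b) ^ (N - i) * (a - b) ^ i"
    using False by (simp add: algebra_simps)
  finally show ?thesis .
qed

text \<open>Entry (i, j) of XPXPX = (1 + (q-1)x)^N P for X = diag(x^i). Both sides are coefficients
  of polynomials in z: summing over j first gives a generating function at xz, and the sum over k is
  then a homogeneous generating function.\<close>

lemma krawtchouk_twisted_square:
  fixes x :: complex
  assumes x: "1 - 2 * x + of_nat q * x + x ^ 2 = 0" and i: "i \<le> N" and j: "j \<le> N"
  shows "x ^ i * (\<Sum>k\<le>N. krawtchouk N q k i * x ^ k * krawtchouk N q j k) * x ^ j =
    (1 + (of_nat q - 1) * x) ^ N * krawtchouk N q j i"
proof -
  define m where "m = 1 + (of_nat q - 1) * x"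
  have "(\<Sum>j\<le>N. x ^ i * (\<Sum>k\<le>N. krawtchouk N q k i * x ^ k * krawtchouk N q j k) * x ^ j * z ^ j) =
      (\<Sum>j\<le>N. m ^ N * krawtchouk N q j i * z ^ j)" for z
  proof -
    define a where "a = 1 + (of_nat q - 1) * (x * z)"
    define b where "b = x * (1 - x * z)"
    \<comment> \<open>The quadratic equation makes the linear forms a + (q-1)b and x(a - b) equal to
      \<open>m\<close> times 1 + (q-1)z and 1 - z, the two factors of the generating function of P.
      The displayed cofactors show the divisibility by the quadratic.\<close>
    have "a + (of_nat q - 1) * b - m * (1 + (of_nat q - 1) * z) =
        (1 - 2 * x + of_nat q * x + x ^ 2) * ((1 - of_nat q) * z)"
      by (simp add: a_def b_def m_def algebra_simps power2_eq_square)
    then have ab1: "a + (of_nat q - 1) * b = m * (1 + (of_nat q - 1) * z)"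
      using x by simp
    have "x * (a - b) - m * (1 - z) = (1 - 2 * x + of_nat q * x + x ^ 2) * ((1 + x) * z - 1)"
      by (simp add: a_def b_def m_def algebra_simps power2_eq_square)
    then have ab2: "x * (a - b) = m * (1 - z)"
      using x by simp
    have "(\<Sum>j\<le>N. x ^ i * (\<Sum>k\<le>N. krawtchouk N q k i * x ^ k * krawtchouk N q j k) * x ^ j * z ^ j) =
        (\<Sum>j\<le>N. \<Sum>k\<le>N. x ^ i * (krawtchouk N q k i * x ^ k * (krawtchouk N q j k * (x * z) ^ j)))"
      by (simp add: sum_distrib_left sum_distrib_right power_mult_distrib mult_ac)
    also have "\<dots> = (\<Sum>k\<le>N. \<Sum>j\<le>N. x ^ i * (krawtchouk N q k i * x ^ k * (krawtchouk N q j k * (x * z) ^ j)))"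
      by (rule sum.swap)
    also have "\<dots> = x ^ i * (\<Sum>k\<le>N. krawtchouk N q k i * x ^ k * poly (kraw_gen N q k) (x * z))"
      by (simp add: sum_distrib_left poly_kraw_gen_sum)
    also have "\<dots> = x ^ i * (\<Sum>k\<le>N. krawtchouk N q k i * a ^ (N - k) * b ^ k)"
      by (simp add: poly_kraw_gen a_def b_def power_mult_distrib mult_ac)
    also have "\<dots> = (m * (1 + (of_nat q - 1) * z)) ^ (N - i) * (x * (a - b)) ^ i"
      unfolding krawtchouk_homogeneous[OF i] ab1 power_mult_distrib[of x] by (simp only: mult_ac)
    also have "\<dots> = m ^ (N - i) * m ^ i * poly (kraw_gen N q i) z"
      by (simp add: ab2 poly_kraw_gen power_mult_distrib mult_ac)
    also have "\<dots> = (\<Sum>j\<le>N. m ^ N * krawtchouk N q j i * z ^ j)"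
      using i by (simp add: power_add[symmetric] poly_kraw_gen_sum sum_distrib_left mult_ac)
    finally show ?thesis .
  qed
  then show ?thesis
    using j polyfun_eq_coeffs[of "\<lambda>j. x ^ i * (\<Sum>k\<le>N. krawtchouk N q k i * x ^ k * krawtchouk N q j k) * x ^ j"
        N "\<lambda>j. m ^ N * krawtchouk N q j i"] m_def by blast
qed

section \<open>Products of banded and of square matrices\<close>

text \<open>In a product of upper bandwidths 1 and b, an index rises by at most b + 1, and it rises
  by exactly that much along a single path.\<close>

lemma mult_mat_superdiag:
  fixes X Y :: "'a :: semiring_0 mat"
  assumes XY: "X \<in> carrier_mat n n" "Y \<in> carrier_mat n n"
    and X: "\<And>i j. i < n \<Longrightarrow> j < n \<Longrightarrow> Suc i < j \<Longrightarrow> X $$ (i, j) = 0"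
    and Y: "\<And>i j. i < n \<Longrightarrow> j < n \<Longrightarrow> i + b < j \<Longrightarrow> Y $$ (i, j) = 0"
  shows "i < n \<Longrightarrow> j < n \<Longrightarrow> Suc (i + b) < j \<Longrightarrow> (X * Y) $$ (i, j) = 0"
    and "Suc (i + b) < n \<Longrightarrow>
      (X * Y) $$ (i, Suc (i + b)) = X $$ (i, Suc i) * Y $$ (Suc i, Suc (i + b))"
proof -
  have e: "(X * Y) $$ (i, j) = (\<Sum>k\<in>{0..<n}. X $$ (i, k) * Y $$ (k, j))" if "i < n" "j < n" for i j
    using XY that by (auto simp: scalar_prod_def)
  show "(X * Y) $$ (i, j) = 0" if "i < n" "j < n" "Suc (i + b) < j"
    unfolding e[OF that(1,2)]
  proof (intro sum.neutral ballI)
    fix k assume "k \<in> {0..<n}"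
    then show "X $$ (i, k) * Y $$ (k, j) = 0"
      using X[of i k] Y[of k j] that by (cases "Suc i < k") auto
  qed
  assume n: "Suc (i + b) < n"
  have "(\<Sum>k\<in>{0..<n}. X $$ (i, k) * Y $$ (k, Suc (i + b))) =
      (\<Sum>k\<in>{Suc i}. X $$ (i, k) * Y $$ (k, Suc (i + b)))"
  proof (intro sum.mono_neutral_right ballI)
    fix k assume "k \<in> {0..<n} - {Suc i}"
    then show "X $$ (i, k) * Y $$ (k, Suc (i + b)) = 0"
      using X[of i k] Y[of k "Suc (i + b)"] n by (cases "Suc i < k") auto
  qed (use n in auto)
  then show "(X * Y) $$ (i, Suc (i + b)) = X $$ (i, Suc i) * Y $$ (Suc i, Suc (i + b))"
    using e[of i "Suc (i + b)"] n by simp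
qed

text \<open>Three tridiagonal factors connect 0 to 3 only along 0, 1, 2, 3, so a matrix equation in
  such products becomes a scalar equation at this entry.\<close>

lemma mult3_superdiag:
  fixes X Y Z :: "'a :: semiring_0 mat"
  assumes XYZ: "X \<in> carrier_mat n n" "Y \<in> carrier_mat n n" "Z \<in> carrier_mat n n"
    and X: "\<And>i j. i < n \<Longrightarrow> j < n \<Longrightarrow> Suc i < j \<Longrightarrow> X $$ (i, j) = 0"
    and Y: "\<And>i j. i < n \<Longrightarrow> j < n \<Longrightarrow> Suc i < j \<Longrightarrow> Y $$ (i, j) = 0"
    and Z: "\<And>i j. i < n \<Longrightarrow> j < n \<Longrightarrow> Suc i < j \<Longrightarrow> Z $$ (i, j) = 0"
    and n: "3 < n"
  shows "(X * (Y * Z)) $$ (0, 3) = X $$ (0, 1) * (Y $$ (1, 2) * Z $$ (2, 3))"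
proof -
  have YZ: "(Y * Z) $$ (i, j) = 0" if "i < n" "j < n" "i + 2 < j" for i j
    using mult_mat_superdiag(1)[OF XYZ(2,3) Y, of 1 i j] Z that by simp
  have "(Y * Z) $$ (1, 3) = Y $$ (1, 2) * Z $$ (2, 3)"
    using mult_mat_superdiag(2)[OF XYZ(2,3) Y, of 1 1] Z n
    by (simp add: numeral_2_eq_2 numeral_3_eq_3)
  then show ?thesis
    using mult_mat_superdiag(2)[OF XYZ(1) mult_carrier_mat[OF XYZ(2,3)] X, of 2 0] YZ n
    by (simp add: numeral_2_eq_2 numeral_3_eq_3)
qed

text \<open>The transpose of \<open>mult3_superdiag\<close>. Transposition reverses the order of the
  factors, so the entries have to commute.\<close>

lemma mult3_subdiag:
  fixes X Y Z :: "'a :: comm_semiring_0 mat"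
  assumes XYZ: "X \<in> carrier_mat n n" "Y \<in> carrier_mat n n" "Z \<in> carrier_mat n n"
    and X: "\<And>i j. i < n \<Longrightarrow> j < n \<Longrightarrow> Suc j < i \<Longrightarrow> X $$ (i, j) = 0"
    and Y: "\<And>i j. i < n \<Longrightarrow> j < n \<Longrightarrow> Suc j < i \<Longrightarrow> Y $$ (i, j) = 0"
    and Z: "\<And>i j. i < n \<Longrightarrow> j < n \<Longrightarrow> Suc j < i \<Longrightarrow> Z $$ (i, j) = 0"
    and n: "3 < n"
  shows "(X * (Y * Z)) $$ (3, 0) = X $$ (3, 2) * (Y $$ (2, 1) * Z $$ (1, 0))"
proof -
  have "transpose_mat (X * (Y * Z)) = transpose_mat Z * (transpose_mat Y * transpose_mat X)"
    using XYZ by (simp add: transpose_mult[of _ n n _ n] assoc_mult_mat[of _ n n _ n _ n])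
  moreover have "(transpose_mat Z * (transpose_mat Y * transpose_mat X)) $$ (0, 3) =
      transpose_mat Z $$ (0, 1) * (transpose_mat Y $$ (1, 2) * transpose_mat X $$ (2, 3))"
    by (rule mult3_superdiag[of _ n]) (use XYZ X Y Z n in auto)
  ultimately show ?thesis
    using XYZ n index_transpose_mat(1)[of 0 "X * (Y * Z)" 3] by (simp add: mult_ac)
qed

lemma square_mat_mult_closed:
  "A \<in> carrier_mat n n \<Longrightarrow> B \<in> carrier_mat n n \<Longrightarrow> A * B \<in> carrier_mat n n"
  by (rule mult_carrier_mat)

lemma square_mat_mult_assoc:
  fixes A B C :: "'a :: semiring_0 mat"
  shows "A \<in> carrier_mat n n \<Longrightarrow> B \<in> carrier_mat n n \<Longrightarrow> C \<in> carrier_mat n n \<Longrightarrow>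
    A * B * C = A * (B * C)"
  by (rule assoc_mult_mat)

lemma square_mat_mult_index:
  assumes "A \<in> carrier_mat n n" "B \<in> carrier_mat n n" "i < n" "j < n"
  shows "(A * B) $$ (i, j) = (\<Sum>k\<in>{0..<n}. A $$ (i, k) * B $$ (k, j))"
  using assms by (auto simp: scalar_prod_def)

text \<open>The form in which an intertwining relation can be applied inside a longer product
  bracketed to the right.\<close>

lemma mat_cross_assoc:
  fixes A B C D X :: "'a :: semiring_0 mat"
  assumes "A * B = C * D"
    and "A \<in> carrier_mat n n" "B \<in> carrier_mat n n" "C \<in> carrier_mat n n"
      "D \<in> carrier_mat n n" "X \<in> carrier_mat n n"
  shows "A * (B * X) = C * (D * X)"
proof -
  have "A * (B * X) = A * B * X" "C * (D * X) = C * D * X"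
    by (rule square_mat_mult_assoc[symmetric, of _ n]; fact assms)+
  then show ?thesis by (simp only: assms(1))
qed

lemma smult_mat_cancel:
  fixes c :: "'a :: field"
  assumes "c \<cdot>\<^sub>m X = c \<cdot>\<^sub>m Y" and "c \<noteq> 0"
  shows "X = Y"
proof -
  have d: "dim_row X = dim_row Y" "dim_col X = dim_col Y"
    using arg_cong[OF assms(1), of dim_row] arg_cong[OF assms(1), of dim_col] by simp_all
  show ?thesis
  proof (rule eq_matI[OF _ d])
    fix i j assume "i < dim_row Y" "j < dim_col Y"
    then show "X $$ (i, j) = Y $$ (i, j)"
      using arg_cong[OF assms(1), of "\<lambda>A. A $$ (i, j)"] d assms(2) by simp
  qed
qed

section \<open>The tridiagonal matrix of the difference equation\<close>

text \<open>The coefficients are the intersection numbers c_i = i, a_i = (q-2)i and b_i = (N-i)(q-1)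
  of the Hamming graph.\<close>

definition krawtchouk_step :: "nat \<Rightarrow> nat \<Rightarrow> nat \<Rightarrow> nat \<Rightarrow> complex" where
  "krawtchouk_step N q i k = of_nat i * of_bool (i = Suc k) + (of_nat q - 2) * of_nat i * of_bool (i = k) +
     of_nat (N - i) * (of_nat q - 1) * of_bool (k = Suc i)"

definition hamming_step_mat :: "nat \<Rightarrow> nat \<Rightarrow> complex mat" where
  "hamming_step_mat N q = mat (N + 1) (N + 1) (\<lambda>(i, k). krawtchouk_step N q i k)"

definition hamming_eigenvalue :: "nat \<Rightarrow> nat \<Rightarrow> nat \<Rightarrow> complex" where
  "hamming_eigenvalue N q i = of_nat N * (of_nat q - 1) - of_nat q * of_nat i"

text \<open>At i = 0 and i = N one of the displayed neighbours is not an index of the sum, but its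
  coefficient is 0.\<close>

lemma sum_krawtchouk_step:
  assumes "i \<le> N"
  shows "(\<Sum>k\<in>{0..<Suc N}. krawtchouk_step N q i k * f k) =
    of_nat i * f (i - 1) + (of_nat q - 2) * of_nat i * f i + of_nat (N - i) * (of_nat q - 1) * f (Suc i)"
proof -
  have 1: "(\<Sum>k\<in>{0..<Suc N}. of_nat i * of_bool (i = Suc k) * f k) = of_nat i * f (i - 1)"
  proof (cases i)
    case (Suc l)
    then show ?thesis using assms by (simp add: if_distrib[of "\<lambda>x. _ * x"] of_bool_def if_distrib[of "\<lambda>x. x * _"] cong: if_cong)
  qed simp
  have 2: "(\<Sum>k\<in>{0..<Suc N}. (of_nat q - 2) * of_nat i * of_bool (i = k) * f k) = (of_nat q - 2) * of_nat i * f i"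
    using assms by (simp add: of_bool_def if_distrib[of "\<lambda>x. _ * x"] if_distrib[of "\<lambda>x. x * _"] cong: if_cong)
  have 3: "(\<Sum>k\<in>{0..<Suc N}. of_nat (N - i) * (of_nat q - 1) * of_bool (k = Suc i) * f k) =
      of_nat (N - i) * (of_nat q - 1) * f (Suc i)"
    using assms by (cases "i = N") (simp_all add: of_bool_def if_distrib[of "\<lambda>x. _ * x"] if_distrib[of "\<lambda>x. x * _"] cong: if_cong)
  show ?thesis
    unfolding krawtchouk_step_def distrib_right sum.distrib 1 2 3 ..
qed

lemma hamming_carrier [simp]:
  "hamming_eigenmatrix N q \<in> carrier_mat (Suc N) (Suc N)"
  "hamming_step_mat N q \<in> carrier_mat (Suc N) (Suc N)"
  by (simp_all add: hamming_eigenmatrix_def hamming_step_mat_def)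

lemma hamming_dim [simp]:
  "dim_row (hamming_eigenmatrix N q) = Suc N" "dim_col (hamming_eigenmatrix N q) = Suc N"
  "dim_row (hamming_step_mat N q) = Suc N" "dim_col (hamming_step_mat N q) = Suc N"
  by (simp_all add: hamming_eigenmatrix_def hamming_step_mat_def)

lemma hamming_eigenmatrix_index [simp]:
  "i \<le> N \<Longrightarrow> j \<le> N \<Longrightarrow> hamming_eigenmatrix N q $$ (i, j) = krawtchouk N q j i"
  by (simp add: hamming_eigenmatrix_def)

lemma hamming_step_mat_index [simp]:
  "i \<le> N \<Longrightarrow> j \<le> N \<Longrightarrow> hamming_step_mat N q $$ (i, j) = krawtchouk_step N q i j"
  by (simp add: hamming_step_mat_def)

text \<open>Self-duality: the orthogonality relation involves P alone, so P is its own inverse up to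
  the factor \<open>q ^ N\<close>.\<close>

lemma hamming_eigenmatrix_square:
  "hamming_eigenmatrix N q * hamming_eigenmatrix N q = of_nat q ^ N \<cdot>\<^sub>m 1\<^sub>m (Suc N)"
  (is "?P * ?P = _")
proof (rule eq_matI)
  fix i j assume "i < dim_row (of_nat q ^ N \<cdot>\<^sub>m 1\<^sub>m (Suc N) :: complex mat)" "j < dim_col (of_nat q ^ N \<cdot>\<^sub>m 1\<^sub>m (Suc N) :: complex mat)"
  then have ij: "i \<le> N" "j \<le> N" by auto
  have "(?P * ?P) $$ (i, j) = (\<Sum>k\<le>N. krawtchouk N q k i * krawtchouk N q j k)"
    using ij
    by (auto simp: scalar_prod_def atLeast0LessThan lessThan_Suc_atMost intro!: sum.cong)
  also have "\<dots> = (\<Sum>k\<le>N. krawtchouk N q j k * krawtchouk N q k i)"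
    by (simp add: mult.commute)
  finally show "(?P * ?P) $$ (i, j) = (of_nat q ^ N \<cdot>\<^sub>m 1\<^sub>m (Suc N)) $$ (i, j)"
    using ij by (simp add: krawtchouk_orthogonal)
qed (simp_all add: hamming_eigenmatrix_def)

lemma hamming_step_eigenmatrix:
  "hamming_step_mat N q * hamming_eigenmatrix N q =
    hamming_eigenmatrix N q * mat_diag (Suc N) (hamming_eigenvalue N q)" (is "?B * ?P = ?P * ?D")
proof (rule eq_matI)
  have PD: "?P * ?D = mat (Suc N) (Suc N) (\<lambda>(i, j). ?P $$ (i, j) * hamming_eigenvalue N q j)"
    by (rule mat_diag_mult_right) simp
  fix i j assume "i < dim_row (?P * ?D)" "j < dim_col (?P * ?D)"
  then have ij: "i \<le> N" "j \<le> N" by (auto simp: PD)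
  have "(?B * ?P) $$ (i, j) = (\<Sum>k\<in>{0..<Suc N}. krawtchouk_step N q i k * krawtchouk N q j k)"
    using ij by (auto simp: scalar_prod_def intro!: sum.cong)
  then show "(?B * ?P) $$ (i, j) = (?P * ?D) $$ (i, j)"
    unfolding sum_krawtchouk_step[OF ij(1)] krawtchouk_difference[OF ij] PD
    using ij by (simp add: hamming_eigenvalue_def)
qed (simp_all add: hamming_eigenmatrix_def hamming_step_mat_def mat_diag_def)


lemma hamming_eigenmatrix_square_mult:
  assumes "X \<in> carrier_mat (Suc N) (Suc N)"
  shows "hamming_eigenmatrix N q * (hamming_eigenmatrix N q * X) = of_nat q ^ N \<cdot>\<^sub>m X" (is "?P * _ = _")
    and "X * (hamming_eigenmatrix N q * hamming_eigenmatrix N q) = of_nat q ^ N \<cdot>\<^sub>m X"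
proof -
  have "?P * (?P * X) = ?P * ?P * X"
    by (rule assoc_mult_mat[symmetric, of _ "Suc N" "Suc N" _ "Suc N" _ "Suc N"]) (use assms in simp_all)
  also have "\<dots> = of_nat q ^ N \<cdot>\<^sub>m (1\<^sub>m (Suc N) * X)"
    unfolding hamming_eigenmatrix_square by (rule mult_smult_assoc_mat[of _ "Suc N" "Suc N" _ "Suc N"]) (use assms in simp_all)
  finally show "?P * (?P * X) = of_nat q ^ N \<cdot>\<^sub>m X"
    using assms by simp
  have "X * (?P * ?P) = of_nat q ^ N \<cdot>\<^sub>m (X * 1\<^sub>m (Suc N))"
    unfolding hamming_eigenmatrix_square by (rule mult_smult_distrib[of _ "Suc N" "Suc N" _ "Suc N"]) (use assms in simp_all)
  then show "X * (?P * ?P) = of_nat q ^ N \<cdot>\<^sub>m X"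
    using assms by simp
qed

lemma hamming_eigenmatrix_cancel:
  assumes "q > 0" and XY: "X \<in> carrier_mat (Suc N) (Suc N)" "Y \<in> carrier_mat (Suc N) (Suc N)"
    and eq: "X * hamming_eigenmatrix N q = Y * hamming_eigenmatrix N q" (is "_ * ?P = _")
  shows "X = Y"
proof -
  have sq: "Z * ?P * ?P = of_nat q ^ N \<cdot>\<^sub>m Z" if "Z \<in> carrier_mat (Suc N) (Suc N)" for Z
    using that
    by (subst assoc_mult_mat[of _ "Suc N" "Suc N" _ "Suc N" _ "Suc N"])
       (auto intro!: hamming_eigenmatrix_square_mult(2))
  show ?thesis
    by (rule smult_mat_cancel[of "of_nat q ^ N"])
       (use sq[OF XY(1)] sq[OF XY(2)] eq assms(1) in simp_all)
qed

text \<open>The dual of BP = PD. Both PB and DP become \<open>q ^ N\<close> times D when multiplied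
  by P on the right, and P can be cancelled.\<close>

lemma hamming_eigenmatrix_step:
  assumes "q > 0"
  shows "hamming_eigenmatrix N q * hamming_step_mat N q =
    mat_diag (Suc N) (hamming_eigenvalue N q) * hamming_eigenmatrix N q" (is "?P * ?B = ?D * ?P")
proof (rule hamming_eigenmatrix_cancel[OF assms])
  have "?P * ?B * ?P = ?P * (?B * ?P)"
    by (rule assoc_mult_mat[of _ "Suc N" "Suc N" _ "Suc N" _ "Suc N"]) simp_all
  also have "\<dots> = of_nat q ^ N \<cdot>\<^sub>m ?D"
    by (simp add: hamming_step_eigenmatrix hamming_eigenmatrix_square_mult(1))
  also have "\<dots> = ?D * (?P * ?P)"
    by (simp add: hamming_eigenmatrix_square_mult(2))
  also have "\<dots> = ?D * ?P * ?P"
    by (rule assoc_mult_mat[symmetric, of _ "Suc N" "Suc N" _ "Suc N" _ "Suc N"]) simp_all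
  finally show "?P * ?B * ?P = ?D * ?P * ?P" .
qed (simp_all add: mult_carrier_mat[of _ "Suc N" "Suc N"])

section \<open>The cube of PT for geometric T\<close>

lemma twisted_cube:
  fixes x c :: complex
  assumes x: "1 - 2 * x + of_nat q * x + x ^ 2 = 0" and t: "\<And>i. i \<le> N \<Longrightarrow> t i = c * x ^ i"
  shows "(hamming_eigenmatrix N q * mat_diag (Suc N) t) ^\<^sub>m 3 =
    (c ^ 3 * (of_nat q * (1 + (of_nat q - 1) * x)) ^ N) \<cdot>\<^sub>m 1\<^sub>m (Suc N)"
proof -
  let ?P = "hamming_eigenmatrix N q" and ?T = "mat_diag (Suc N) t"
  let ?m = "c ^ 3 * (1 + (of_nat q - 1) * x) ^ N"
  have c: "?P * ?T \<in> carrier_mat (Suc N) (Suc N)" "?T * ?P \<in> carrier_mat (Suc N) (Suc N)"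
    by (simp_all add: square_mat_mult_closed)
  have cT: "?T * (?P * ?T) \<in> carrier_mat (Suc N) (Suc N)"
    by (rule square_mat_mult_closed[OF _ c(1)]) simp
  have TP: "(?T * ?P) $$ (i, j) = t i * krawtchouk N q j i" if "i \<le> N" "j \<le> N" for i j
    using that by (simp add: mat_diag_mult_left[of _ _ "Suc N"])
  have TPT: "(?T * (?P * ?T)) $$ (i, j) = t i * (krawtchouk N q j i * t j)" if "i \<le> N" "j \<le> N" for i j
    unfolding mat_diag_mult_left[OF c(1)] using that by (simp add: mat_diag_mult_right[of _ "Suc N"])
  \<comment> \<open>With T = cX this is c^3 times the twisted square XPXPX. One further factor P on
    the left then gives a multiple of P^2, which is scalar.\<close>
  have eq: "(?T * ?P) * (?T * (?P * ?T)) = ?m \<cdot>\<^sub>m ?P"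
  proof (rule eq_matI)
    fix i j assume "i < dim_row (?m \<cdot>\<^sub>m ?P)" "j < dim_col (?m \<cdot>\<^sub>m ?P)"
    then have ij: "i \<le> N" "j \<le> N" by auto
    have "((?T * ?P) * (?T * (?P * ?T))) $$ (i, j) =
        (\<Sum>k\<in>{0..<Suc N}. (?T * ?P) $$ (i, k) * (?T * (?P * ?T)) $$ (k, j))"
      by (rule square_mat_mult_index[OF c(2) cT]) (use ij in auto)
    also have "\<dots> = (\<Sum>k\<le>N. t i * krawtchouk N q k i * (t k * (krawtchouk N q j k * t j)))"
      unfolding atLeast0LessThan lessThan_Suc_atMost
      by (intro sum.cong refl) (simp add: TP TPT ij)
    also have "\<dots> = c ^ 3 * (x ^ i * (\<Sum>k\<le>N. krawtchouk N q k i * x ^ k * krawtchouk N q j k) * x ^ j)"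
      unfolding sum_distrib_left sum_distrib_right
    proof (intro sum.cong refl)
      fix k assume "k \<in> {..N}"
      then have "t k = c * x ^ k" by (simp add: t)
      then show "t i * krawtchouk N q k i * (t k * (krawtchouk N q j k * t j)) =
          c ^ 3 * (x ^ i * (krawtchouk N q k i * x ^ k * krawtchouk N q j k) * x ^ j)"
        unfolding t[OF ij(1)] t[OF ij(2)] power3_eq_cube by (simp only: mult_ac)
    qed
    also have "\<dots> = ?m * krawtchouk N q j i"
      unfolding krawtchouk_twisted_square[OF x ij] by (simp only: mult_ac)
    finally show "((?T * ?P) * (?T * (?P * ?T))) $$ (i, j) = (?m \<cdot>\<^sub>m ?P) $$ (i, j)"
      using ij by simp
  qed (use c(2) cT in auto)
  have "(?P * ?T) ^\<^sub>m 3 = ?P * ((?T * ?P) * (?T * (?P * ?T)))"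
  proof -
    have "(?P * ?T) ^\<^sub>m 3 = ?P * ?T * (?P * ?T) * (?P * ?T)"
      using c(1) by (simp add: numeral_3_eq_3 del: assoc_mult_mat)
    then show ?thesis
      by (simp add: square_mat_mult_assoc[of _ "Suc N"] square_mat_mult_closed[of _ "Suc N"]
          del: assoc_mult_mat mult_carrier_mat)
  qed
  also have "\<dots> = ?m \<cdot>\<^sub>m (?P * ?P)"
    unfolding eq by (rule mult_smult_distrib[of _ "Suc N" "Suc N" _ "Suc N"]) simp_all
  also have "\<dots> = ?m \<cdot>\<^sub>m (of_nat q ^ N \<cdot>\<^sub>m 1\<^sub>m (Suc N))"
    by (simp only: hamming_eigenmatrix_square)
  also have "?m \<cdot>\<^sub>m (of_nat q ^ N \<cdot>\<^sub>m 1\<^sub>m (Suc N)) = (?m * of_nat q ^ N) \<cdot>\<^sub>m 1\<^sub>m (Suc N)"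
    by (rule eq_matI) auto
  finally show ?thesis
    by (simp only: power_mult_distrib mult.assoc mult.commute[of "of_nat q ^ N"])
qed

section \<open>Diagonal matrices with \<open>(PT)\<^sup>3 = I\<close>\<close>

text \<open>The hypothesis says that U = PTPTP is a left inverse of T. Hence T is invertible, U =
  T^-1, and U can be commuted past B by the intertwining relations for P.\<close>

lemma cube_one_conjugation:
  fixes t :: "nat \<Rightarrow> complex"
  assumes q: "q > 0"
    and cube: "(hamming_eigenmatrix N q * mat_diag (Suc N) t) ^\<^sub>m 3 = 1\<^sub>m (Suc N)"
  defines "S \<equiv> mat_diag (Suc N) (\<lambda>i. 1 / t i)" and "T \<equiv> mat_diag (Suc N) t"
  shows "i \<le> N \<Longrightarrow> t i \<noteq> 0"
    and "S * (hamming_step_mat N q * T) * hamming_eigenmatrix N q =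
      hamming_eigenmatrix N q * (T * (hamming_step_mat N q * S))"
proof -
  let ?P = "hamming_eigenmatrix N q" and ?B = "hamming_step_mat N q"
    and ?D = "mat_diag (Suc N) (hamming_eigenvalue N q)"
  note assoc = square_mat_mult_assoc[of _ "Suc N"]
  note closed = square_mat_mult_closed[of _ "Suc N"]
  have ST [simp]: "S \<in> carrier_mat (Suc N) (Suc N)" "T \<in> carrier_mat (Suc N) (Suc N)"
    by (simp_all add: S_def T_def)
  define U where "U = ?P * (T * (?P * (T * ?P)))"
  have U [simp]: "U \<in> carrier_mat (Suc N) (Suc N)"
    by (simp add: U_def closed del: assoc_mult_mat mult_carrier_mat)
  have "?P * T \<in> carrier_mat (Suc N) (Suc N)"
    by (simp add: closed del: assoc_mult_mat mult_carrier_mat)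
  then have "(?P * T) ^\<^sub>m 3 = ?P * T * (?P * T) * (?P * T)"
    by (simp add: numeral_3_eq_3 del: assoc_mult_mat)
  then have UT: "U * T = 1\<^sub>m (Suc N)"
    using cube unfolding T_def[symmetric] U_def
    by (simp add: assoc closed del: assoc_mult_mat mult_carrier_mat)
  \<comment> \<open>A zero t_i would make column i of UT = I vanish.\<close>
  have t0: "t i \<noteq> 0" if "i \<le> N" for i
  proof
    assume "t i = 0"
    then have "(U * T) $$ (i, i) = 0"
      using that by (simp add: T_def mat_diag_mult_right[OF U])
    then show False using that by (simp add: UT)
  qed
  then show "i \<le> N \<Longrightarrow> t i \<noteq> 0" .
  have "T * S = 1\<^sub>m (Suc N)"
    unfolding T_def S_def mat_diag_diag by (rule eq_matI) (auto simp: mat_diag_def t0)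
  then have "U * (T * S) = U"
    by (simp add: right_mult_one_mat[OF U])
  moreover have "U * (T * S) = U * T * S"
    by (rule assoc[symmetric]) simp_all
  ultimately have US: "U = S"
    by (simp add: UT left_mult_one_mat[OF ST(1)])
  have BP: "?B * (?P * X) = ?P * (?D * X)" if "X \<in> carrier_mat (Suc N) (Suc N)" for X
    by (rule mat_cross_assoc[OF hamming_step_eigenmatrix, where n = "Suc N"]) (use that in simp_all)
  have PB: "?P * (?B * X) = ?D * (?P * X)" if "X \<in> carrier_mat (Suc N) (Suc N)" for X
    by (rule mat_cross_assoc[OF hamming_eigenmatrix_step[OF q], where n = "Suc N"]) (use that in simp_all)
  have TD: "T * (?D * X) = ?D * (T * X)" if "X \<in> carrier_mat (Suc N) (Suc N)" for X
    by (rule mat_cross_assoc[where n = "Suc N"]) (use that in \<open>simp_all add: T_def mult.commute\<close>)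
  \<comment> \<open>In PTPTP B TP the matrix B moves left: PB = DP turns it into D, D passes the
    diagonal T, and PD = BP turns it back into B. What follows B is then PTPTP = U again.\<close>
  have "U * (?B * (T * ?P)) = ?P * (T * (?B * U))"
    by (simp add: U_def assoc closed BP[symmetric] PB TD del: assoc_mult_mat mult_carrier_mat)
  then show "S * (?B * T) * ?P = ?P * (T * (?B * S))"
    by (simp add: US assoc closed del: assoc_mult_mat mult_carrier_mat)
qed

text \<open>
  The relations for \<open>[D, [D, C']]\<close> and \<open>[B, [B, C]]\<close>, with terms moved so that no subtraction occurs.
\<close>

lemma intertwined_commutator:
  fixes B C C' D P :: "'a :: comm_ring_1 mat"
  assumes carrier [simp]: "B \<in> carrier_mat n n" "C \<in> carrier_mat n n" "C' \<in> carrier_mat n n"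
      "D \<in> carrier_mat n n" "P \<in> carrier_mat n n"
    and BP: "B * P = P * D" and CP: "C * P = P * C'"
    and D: "D * (D * C') + C' * (D * D) + a \<cdot>\<^sub>m 1\<^sub>m n = 2 \<cdot>\<^sub>m (D * (C' * D)) + b \<cdot>\<^sub>m C' + c \<cdot>\<^sub>m D"
  shows "(B * (B * C) + C * (B * B) + a \<cdot>\<^sub>m 1\<^sub>m n) * P = (2 \<cdot>\<^sub>m (B * (C * B)) + b \<cdot>\<^sub>m C + c \<cdot>\<^sub>m B) * P"
proof -
  note rules = square_mat_mult_assoc[of _ n] square_mat_mult_closed[of _ n]
    add_mult_distrib_mat[of _ n n _ _ n] mult_add_distrib_mat[of _ n n _ n]
    mult_smult_assoc_mat[of _ n n _ n] mult_smult_distrib[of _ n n _ n]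
    left_mult_one_mat[of _ n n] right_mult_one_mat[of _ n n]
  have BPX: "B * (P * X) = P * (D * X)" if "X \<in> carrier_mat n n" for X
    by (rule mat_cross_assoc[OF BP, of n]) (use that in simp_all)
  have CPX: "C * (P * X) = P * (C' * X)" if "X \<in> carrier_mat n n" for X
    by (rule mat_cross_assoc[OF CP, of n]) (use that in simp_all)
  have "(B * (B * C) + C * (B * B) + a \<cdot>\<^sub>m 1\<^sub>m n) * P = P * (D * (D * C') + C' * (D * D) + a \<cdot>\<^sub>m 1\<^sub>m n)"
    by (simp add: rules BP CP BPX CPX del: assoc_mult_mat mult_carrier_mat)
  also have "\<dots> = (2 \<cdot>\<^sub>m (B * (C * B)) + b \<cdot>\<^sub>m C + c \<cdot>\<^sub>m B) * P"
    unfolding D by (simp add: rules BP CP BPX CPX del: assoc_mult_mat mult_carrier_mat)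
  finally show ?thesis .
qed

lemma krawtchouk_step_commutator:
  fixes N q :: nat
  assumes "i \<le> N" "j \<le> N"
  defines "\<theta> \<equiv> hamming_eigenvalue N q" and "s \<equiv> of_nat q"
  shows "\<theta> i * (\<theta> i * krawtchouk_step N q i j) + krawtchouk_step N q i j * (\<theta> j * \<theta> j) +
      s * (s - 2) * (of_nat N * (s - 1)) * of_bool (i = j) =
    2 * (\<theta> i * (krawtchouk_step N q i j * \<theta> j)) + s\<^sup>2 * krawtchouk_step N q i j +
      s * (s - 2) * \<theta> j * of_bool (i = j)"
proof -
  \<comment> \<open>Neighbouring eigenvalues differ by q, so the double commutator multiplies
    off-diagonal entries by q^2. On the diagonal it vanishes, and the affine terms balance q^2 (q-2)
    i because N(q-1) minus the i-th eigenvalue is qi.\<close>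
  consider "i = j" | "i = Suc j" | "j = Suc i" | "i \<noteq> j" "i \<noteq> Suc j" "j \<noteq> Suc i" by blast
  then show ?thesis
  proof cases
    case 4
    then show ?thesis by (simp add: krawtchouk_step_def)
  qed (simp_all add: krawtchouk_step_def \<theta>_def hamming_eigenvalue_def s_def power2_eq_square algebra_simps)
qed

lemma cube_one_imp_geometric:
  fixes t :: "nat \<Rightarrow> complex"
  assumes N: "N > 2" and q: "q \<ge> 2"
    and cube: "(hamming_eigenmatrix N q * mat_diag (Suc N) t) ^\<^sub>m 3 = 1\<^sub>m (Suc N)"
  obtains x where "1 - 2 * x + of_nat q * x + x ^ 2 = 0" and "\<And>i. i \<le> N \<Longrightarrow> t i = t 0 * x ^ i"
proof -
  define S where "S = mat_diag (Suc N) (\<lambda>i. 1 / t i)"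
  define T where "T = mat_diag (Suc N) t"
  let ?P = "hamming_eigenmatrix N q" and ?B = "hamming_step_mat N q" and ?s = "of_nat q :: complex"
  let ?b = "krawtchouk_step N q" and ?\<theta> = "hamming_eigenvalue N q"
  let ?D = "mat_diag (Suc N) ?\<theta>"
  define C where "C = S * (?B * T)"
  define C' where "C' = T * (?B * S)"
  have q0: "q > 0" and q1: "?s \<noteq> 1" using q by auto
  note t0 = cube_one_conjugation(1)[OF q0 cube]
  have CP: "C * ?P = ?P * C'"
    using cube_one_conjugation(2)[OF q0 cube] by (simp only: C_def C'_def S_def T_def)
  have [simp]: "S \<in> carrier_mat (Suc N) (Suc N)" "T \<in> carrier_mat (Suc N) (Suc N)"
    by (simp_all add: S_def T_def)
  note closed = square_mat_mult_closed[of _ "Suc N"]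
  have C_carrier [simp]: "C \<in> carrier_mat (Suc N) (Suc N)" "C' \<in> carrier_mat (Suc N) (Suc N)"
    by (simp_all add: C_def C'_def closed del: mult_carrier_mat assoc_mult_mat)
  note C_dim [simp] = carrier_matD[OF C_carrier(1)] carrier_matD[OF C_carrier(2)]
  have BT: "?B * T \<in> carrier_mat (Suc N) (Suc N)" and BS: "?B * S \<in> carrier_mat (Suc N) (Suc N)"
    by (simp_all add: closed del: mult_carrier_mat)
  have C: "C $$ (i, j) = ?b i j * t j / t i" if "i \<le> N" "j \<le> N" for i j
    unfolding C_def S_def mat_diag_mult_left[OF BT]
    using that by (simp add: T_def mat_diag_mult_right[of _ "Suc N"])
  have C': "C' $$ (i, j) = t i / t j * ?b i j" if "i \<le> N" "j \<le> N" for i j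
    unfolding C'_def T_def mat_diag_mult_left[OF BS]
    using that by (simp add: S_def mat_diag_mult_right[of _ "Suc N"])
  have col: "of_nat i * t (i - 1) + (?s - 2) * of_nat i * t i + of_nat (N - i) * (?s - 1) * t (Suc i) =
      ?\<theta> i * t i * (t 1 / t 0)" if i: "i \<le> N" for i
  proof -
    have "(C * ?P) $$ (i, 0) = (\<Sum>k\<in>{0..<Suc N}. C $$ (i, k) * ?P $$ (k, 0))"
      by (rule square_mat_mult_index) (use i in auto)
    also have "\<dots> = (\<Sum>k\<in>{0..<Suc N}. ?b i k * t k) / t i"
      unfolding sum_divide_distrib by (intro sum.cong refl) (use i in \<open>simp add: C\<close>)
    finally have 1: "(C * ?P) $$ (i, 0) = (\<Sum>k\<in>{0..<Suc N}. ?b i k * t k) / t i" .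
    have "(?P * C') $$ (i, 0) = (\<Sum>k\<in>{0..<Suc N}. ?P $$ (i, k) * C' $$ (k, 0))"
      by (rule square_mat_mult_index) (use i in auto)
    \<comment> \<open>Column 0 of \<open>C'\<close> is supported in row 1, since its diagonal entry
      (q-2) * 0 vanishes. Column 1 of P holds the eigenvalues, while column 0 of P, used on the
      other side, is constantly 1.\<close>
    also have "\<dots> = (\<Sum>k\<in>{1}. ?P $$ (i, k) * C' $$ (k, 0))"
    proof (intro sum.mono_neutral_right ballI)
      fix k assume "k \<in> {0..<Suc N} - {1}"
      then show "?P $$ (i, k) * C' $$ (k, 0) = 0"
        by (cases "k = 0") (simp_all add: C' krawtchouk_step_def)
    qed (use N in auto)
    also have "\<dots> = ?\<theta> i * (t 1 / t 0)"
      using N i krawtchouk_1[OF i, of q] by (simp add: C' krawtchouk_step_def hamming_eigenvalue_def)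
    finally have "(\<Sum>k\<in>{0..<Suc N}. ?b i k * t k) / t i = ?\<theta> i * (t 1 / t 0)"
      using 1 CP by simp
    then show ?thesis
      using t0[OF i] unfolding sum_krawtchouk_step[OF i] by (simp add: field_simps)
  qed
  have D: "?D * (?D * C') + C' * (?D * ?D) + (?s * (?s - 2) * (of_nat N * (?s - 1))) \<cdot>\<^sub>m 1\<^sub>m (Suc N) =
      2 \<cdot>\<^sub>m (?D * (C' * ?D)) + ?s\<^sup>2 \<cdot>\<^sub>m C' + (?s * (?s - 2)) \<cdot>\<^sub>m ?D" (is "?L = ?R")
  proof -
    have dl: "(?D * X) $$ (i, j) = ?\<theta> i * X $$ (i, j)"
      if "X \<in> carrier_mat (Suc N) (Suc N)" "i \<le> N" "j \<le> N" for X i j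
      using that by (simp add: mat_diag_mult_left[OF that(1)])
    have dr: "(X * mat_diag (Suc N) f) $$ (i, j) = X $$ (i, j) * f j"
      if "X \<in> carrier_mat (Suc N) (Suc N)" "i \<le> N" "j \<le> N" for X f i j
      using that by (simp add: mat_diag_mult_right[OF that(1)])
    have dd: "?D $$ (i, j) = ?\<theta> j * of_bool (i = j)" if "i \<le> N" "j \<le> N" for i j
      using that by (simp add: mat_diag_def)
    have dim: "dim_row ?D = Suc N" "dim_col ?D = Suc N"
      by (simp_all add: mat_diag_def)
    have carr: "?D * C' \<in> carrier_mat (Suc N) (Suc N)" "C' * ?D \<in> carrier_mat (Suc N) (Suc N)"
      "?D * (?D * C') \<in> carrier_mat (Suc N) (Suc N)" "?D * (C' * ?D) \<in> carrier_mat (Suc N) (Suc N)"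
      "C' * (?D * ?D) \<in> carrier_mat (Suc N) (Suc N)"
      by (simp_all add: closed del: mult_carrier_mat assoc_mult_mat mat_diag_diag)
    show ?thesis
    proof (rule eq_matI)
      fix i j assume "i < dim_row ?R" "j < dim_col ?R"
      then have ij: "i \<le> N" "j \<le> N" by (auto simp: dim)
      have "?L $$ (i, j) = ?\<theta> i * (?\<theta> i * C' $$ (i, j)) + C' $$ (i, j) * (?\<theta> j * ?\<theta> j) +
          ?s * (?s - 2) * (of_nat N * (?s - 1)) * of_bool (i = j)"
        using ij carr by (simp add: dl dr del: index_mult_mat(1))
      \<comment> \<open>Conjugation by T scales entry (i, j) by t_i/t_j. This ratio is 1 on the
        diagonal, so the identity for the entries of B carries over together with its diagonal
        terms.\<close>
      also have "\<dots> = t i / t j * (?\<theta> i * (?\<theta> i * ?b i j) + ?b i j * (?\<theta> j * ?\<theta> j) +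
          ?s * (?s - 2) * (of_nat N * (?s - 1)) * of_bool (i = j))"
        using t0[OF ij(1)] t0[OF ij(2)] by (cases "i = j") (simp_all add: C' ij algebra_simps)
      also have "\<dots> = t i / t j * (2 * (?\<theta> i * (?b i j * ?\<theta> j)) + ?s\<^sup>2 * ?b i j +
          ?s * (?s - 2) * ?\<theta> j * of_bool (i = j))"
        by (simp only: krawtchouk_step_commutator[OF ij])
      also have "\<dots> = 2 * (?\<theta> i * (C' $$ (i, j) * ?\<theta> j)) + ?s\<^sup>2 * C' $$ (i, j) +
          ?s * (?s - 2) * ?\<theta> j * of_bool (i = j)"
        using t0[OF ij(1)] t0[OF ij(2)] by (cases "i = j") (simp_all add: C' ij algebra_simps)
      also have "\<dots> = ?R $$ (i, j)"
        using ij carr by (simp add: dl dr dd dim del: index_mult_mat(1))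
      finally show "?L $$ (i, j) = ?R $$ (i, j)" .
    qed (use carr in \<open>auto simp: dim\<close>)
  qed
  have "(?B * (?B * C) + C * (?B * ?B) + (?s * (?s - 2) * (of_nat N * (?s - 1))) \<cdot>\<^sub>m 1\<^sub>m (Suc N)) * ?P =
      (2 \<cdot>\<^sub>m (?B * (C * ?B)) + ?s\<^sup>2 \<cdot>\<^sub>m C + (?s * (?s - 2)) \<cdot>\<^sub>m ?B) * ?P"
    by (rule intertwined_commutator[OF _ _ _ _ _ hamming_step_eigenmatrix CP D]) simp_all
  moreover have "?B * (?B * C) + C * (?B * ?B) + (?s * (?s - 2) * (of_nat N * (?s - 1))) \<cdot>\<^sub>m 1\<^sub>m (Suc N)
      \<in> carrier_mat (Suc N) (Suc N)"
    by (simp add: closed del: mult_carrier_mat assoc_mult_mat)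
  moreover have "2 \<cdot>\<^sub>m (?B * (C * ?B)) + ?s\<^sup>2 \<cdot>\<^sub>m C + (?s * (?s - 2)) \<cdot>\<^sub>m ?B \<in> carrier_mat (Suc N) (Suc N)"
    by (simp add: closed del: mult_carrier_mat assoc_mult_mat)
  ultimately have comm: "?B * (?B * C) + C * (?B * ?B) + (?s * (?s - 2) * (of_nat N * (?s - 1))) \<cdot>\<^sub>m 1\<^sub>m (Suc N) =
      2 \<cdot>\<^sub>m (?B * (C * ?B)) + ?s\<^sup>2 \<cdot>\<^sub>m C + (?s * (?s - 2)) \<cdot>\<^sub>m ?B" (is "?L = ?R")
    by (rule hamming_eigenmatrix_cancel[OF q0, rotated 2])
  have B0: "?B $$ (i, j) = 0" "C $$ (i, j) = 0" if "i < Suc N" "j < Suc N" "Suc i < j \<or> Suc j < i" for i j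
    using that by (auto simp: C krawtchouk_step_def)
  have up: "(X * (Y * Z)) $$ (0, 3) = X $$ (0, 1) * (Y $$ (1, 2) * Z $$ (2, 3))"
    and down: "(X * (Y * Z)) $$ (3, 0) = X $$ (3, 2) * (Y $$ (2, 1) * Z $$ (1, 0))"
    if "X \<in> {?B, C}" "Y \<in> {?B, C}" "Z \<in> {?B, C}" for X Y Z
  proof -
    have X: "X \<in> carrier_mat (Suc N) (Suc N)" "Y \<in> carrier_mat (Suc N) (Suc N)" "Z \<in> carrier_mat (Suc N) (Suc N)"
      using that by auto
    have 0: "W $$ (i, j) = 0" if "W \<in> {?B, C}" "i < Suc N" "j < Suc N" "Suc i < j \<or> Suc j < i" for W i j
      using that(1) B0[OF that(2-4)] by blast
    show "(X * (Y * Z)) $$ (0, 3) = X $$ (0, 1) * (Y $$ (1, 2) * Z $$ (2, 3))"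
      by (rule mult3_superdiag[OF X]) (use 0 that N in auto)
    show "(X * (Y * Z)) $$ (3, 0) = X $$ (3, 2) * (Y $$ (2, 1) * Z $$ (1, 0))"
      by (rule mult3_subdiag[OF X]) (use 0 that N in auto)
  qed
  \<comment> \<open>Outside the three central diagonals I, B and C vanish, so only the cubic
    products remain.\<close>
  have entry: "(?B * (?B * C)) $$ (i, j) + (C * (?B * ?B)) $$ (i, j) = 2 * (?B * (C * ?B)) $$ (i, j)"
    if "i < Suc N" "j < Suc N" "Suc i < j \<or> Suc j < i" for i j
  proof -
    have "i \<noteq> j" using that by auto
    have "?L $$ (i, j) = (?B * (?B * C)) $$ (i, j) + (C * (?B * ?B)) $$ (i, j)"
      using that(1,2) \<open>i \<noteq> j\<close> by (simp del: index_mult_mat(1) assoc_mult_mat)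
    moreover have "?R $$ (i, j) = 2 * (?B * (C * ?B)) $$ (i, j)"
      using that(1,2) B0[OF that] by (simp del: index_mult_mat(1) assoc_mult_mat hamming_step_mat_index)
    ultimately show ?thesis using comm by simp
  qed
  \<comment> \<open>All three products along the path share the same entries of B; dividing by them
    leaves a relation between ratios of consecutive t_i.\<close>
  have cancel: "u + v = 2 * w"
    if "b * (b' * (b'' * u)) + b * v * (b' * b'') = 2 * (b * (b' * w * b''))" "b \<noteq> 0" "b' \<noteq> 0" "b'' \<noteq> 0"
    for b b' b'' u v w :: complex
  proof -
    have "(b * b' * b'') * (u + v) = (b * b' * b'') * (2 * w)"
      using that(1) by (simp only: distrib_left mult_ac)
    then show ?thesis using that(2-4) by simp
  qed
  have nz: "t 0 \<noteq> 0" "t 1 \<noteq> 0" "t 2 \<noteq> 0" "t 3 \<noteq> 0"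
    using t0 N by auto
  have b0: "?b i (Suc i) \<noteq> 0" if "i < N" for i
    using that q1 by (simp add: krawtchouk_step_def)
  have B: "?B $$ (i, j) = ?b i j" "C $$ (i, j) = ?b i j * (t j / t i)" if "i \<le> 3" "j \<le> 3" for i j
    using that N by (simp_all add: C)
  have "?b 0 1 * (?b 1 2 * (?b 2 3 * (t 3 / t 2))) + ?b 0 1 * (t 1 / t 0) * (?b 1 2 * ?b 2 3) =
      2 * (?b 0 1 * (?b 1 2 * (t 2 / t 1) * ?b 2 3))"
    using entry[of 0 3] N by (simp add: up B del: hamming_step_mat_index index_mult_mat(1) assoc_mult_mat)
  then have ap: "t 3 / t 2 + t 1 / t 0 = 2 * (t 2 / t 1)"
    by (rule cancel) (use b0[of 0] b0[of 1] b0[of 2] N in \<open>simp_all add: numeral_2_eq_2 numeral_3_eq_3\<close>)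
  have "?b 3 2 * (?b 2 1 * (?b 1 0 * (t 0 / t 1))) + ?b 3 2 * (t 2 / t 3) * (?b 2 1 * ?b 1 0) =
      2 * (?b 3 2 * (?b 2 1 * (t 1 / t 2) * ?b 1 0))"
    using entry[of 3 0] N by (simp add: down B del: hamming_step_mat_index index_mult_mat(1) assoc_mult_mat)
  then have hp: "t 0 / t 1 + t 2 / t 3 = 2 * (t 1 / t 2)"
    by (rule cancel) (simp_all add: krawtchouk_step_def)
  define x where "x = t 1 / t 0"
  define y where "y = t 2 / t 1"
  define z where "z = t 3 / t 2"
  have xyz: "x \<noteq> 0" "y \<noteq> 0" "z \<noteq> 0" using nz by (simp_all add: x_def y_def z_def)
  have z: "z = 2 * y - x" using ap by (simp add: x_def y_def z_def algebra_simps)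
  have "1 / x + 1 / z = 2 * (1 / y)" using hp by (simp add: x_def y_def z_def)
  then have "(z + x) * y = 2 * (x * z)" using xyz by (simp add: field_simps)
  \<comment> \<open>Inserting z = 2y - x into (z + x)y = 2xz gives 2y^2 = 2x(2y - x), a perfect
    square.\<close>
  then have "2 * (y - x)\<^sup>2 = 0" unfolding z by (simp add: power2_eq_square algebra_simps)
  then have yx: "y = x" by simp
  have t1: "t 1 = t 0 * x" using nz by (simp add: x_def)
  have t2: "t 2 = t 0 * x ^ 2"
    using yx nz t1 by (simp add: y_def power2_eq_square field_simps)
  \<comment> \<open>Row 1 of \<open>col\<close> with t_0, t_1, t_2 already known to be geometric:
    the difference of its two sides is t_0 times the quadratic.\<close>
  have "of_nat (N - 1) = (of_nat N - 1 :: complex)" using N by simp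
  then have "t 0 + (?s - 2) * (t 0 * x) + (of_nat N - 1) * (?s - 1) * (t 0 * x ^ 2) =
      (of_nat N * (?s - 1) - ?s) * (t 0 * x) * x"
    using col[of 1, folded x_def] N t1 t2
    by (simp add: numeral_2_eq_2[symmetric] hamming_eigenvalue_def del: of_nat_diff)
  then have "t 0 * (1 - 2 * x + ?s * x + x ^ 2) = 0"
    by (simp add: power2_eq_square algebra_simps)
  then have root: "1 - 2 * x + ?s * x + x ^ 2 = 0" using nz by simp
  have "t i = t 0 * x ^ i" if "i \<le> N" for i
    using that
  proof (induction i rule: less_induct)
    case (less i)
    show ?case
    proof (cases "i < 2")
      case True
      then show ?thesis using t1 by (auto simp: less_2_cases_iff)
    next
      case False
      then have "i = Suc (Suc (i - 2))" by simp
      then obtain k where k: "i = Suc (Suc k)" ..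
      have IH: "t k = t 0 * x ^ k" "t (Suc k) = t 0 * x ^ Suc k"
        using less.IH[of k] less.IH[of "Suc k"] less.prems k by simp_all
      define K M :: complex where "K = of_nat (Suc k)" and "M = of_nat (N - Suc k)"
      have "Suc k + (N - Suc k) = N" using less.prems k by simp
      then have NM: "of_nat N = K + M" unfolding K_def M_def by (metis of_nat_add)
      have "K * t k + (?s - 2) * K * t (Suc k) + M * (?s - 1) * t i =
          (of_nat N * (?s - 1) - ?s * K) * t (Suc k) * x"
        using col[of "Suc k", folded x_def] less.prems k
        unfolding hamming_eigenvalue_def K_def M_def by simp
      \<comment> \<open>Row k + 1 of \<open>col\<close> determines t_(k+2), because its coefficient
        M(q-1) is nonzero; the deviation from t_0 x^(k+2) is a multiple of the quadratic.\<close>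
      then have "M * (?s - 1) * t i = M * (?s - 1) * (t 0 * x ^ i) -
          K * (t 0 * x ^ k) * (1 - 2 * x + ?s * x + x ^ 2)"
        unfolding NM IH k by (simp add: power2_eq_square algebra_simps)
      then have "M * (?s - 1) * t i = M * (?s - 1) * (t 0 * x ^ i)"
        by (simp add: root)
      moreover have "M * (?s - 1) \<noteq> 0"
        using less.prems k q1 by (simp add: M_def del: of_nat_diff)
      ultimately show ?thesis
        using mult_left_cancel[of "M * (?s - 1)" "t i" "t 0 * x ^ i"] by blast
    qed
  qed
  with root show ?thesis by (rule that)
qed

theorem theorem2:
  fixes N q :: nat and T :: "complex mat"
  assumes "N > 2" and "q \<ge> 2"
    and "T \<in> carrier_mat (N + 1) (N + 1)" and "diagonal_mat T"
  shows "(hamming_eigenmatrix N q * T) ^\<^sub>m 3 = 1\<^sub>m (N + 1) \<longleftrightarrow>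
    (\<exists>x c :: complex.
      1 - 2 * x + of_nat q * x + x ^ 2 = 0 \<and>
      c ^ 3 * (of_nat q * (1 + (of_nat q - 1) * x)) ^ N = 1 \<and>
      (\<forall>i\<le>N. T $$ (i, i) = c * x ^ i))"
proof -
  define t where "t i = T $$ (i, i)" for i
  have T: "T = mat_diag (Suc N) t"
    using assms(3,4) by (intro eq_matI) (auto simp: mat_diag_def t_def diagonal_mat_def)
  have scalar: "k \<cdot>\<^sub>m 1\<^sub>m (Suc N) = (1\<^sub>m (Suc N) :: complex mat) \<longleftrightarrow> k = 1" for k
  proof
    assume "k \<cdot>\<^sub>m 1\<^sub>m (Suc N) = (1\<^sub>m (Suc N) :: complex mat)"
    then have "(k \<cdot>\<^sub>m 1\<^sub>m (Suc N)) $$ (0, 0) = (1\<^sub>m (Suc N) :: complex mat) $$ (0, 0)" by simp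
    then show "k = 1" by simp
  qed (auto intro: eq_matI)
  show ?thesis
  proof
    assume "(hamming_eigenmatrix N q * T) ^\<^sub>m 3 = 1\<^sub>m (N + 1)"
    then have cube: "(hamming_eigenmatrix N q * mat_diag (Suc N) t) ^\<^sub>m 3 = 1\<^sub>m (Suc N)"
      by (simp add: T)
    obtain x where x: "1 - 2 * x + of_nat q * x + x ^ 2 = 0" and tx: "\<And>i. i \<le> N \<Longrightarrow> t i = t 0 * x ^ i"
      using cube_one_imp_geometric[OF assms(1,2) cube] by blast
    \<comment> \<open>Once T is known to be geometric, its cube is an explicit scalar matrix, and
      comparison with I gives the condition on c = t_0.\<close>
    have "(hamming_eigenmatrix N q * mat_diag (Suc N) t) ^\<^sub>m 3 =
        (t 0 ^ 3 * (of_nat q * (1 + (of_nat q - 1) * x)) ^ N) \<cdot>\<^sub>m 1\<^sub>m (Suc N)"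
      by (rule twisted_cube[OF x]) (rule tx)
    then have "t 0 ^ 3 * (of_nat q * (1 + (of_nat q - 1) * x)) ^ N = 1"
      unfolding cube using scalar by metis
    then show "\<exists>x c. 1 - 2 * x + of_nat q * x + x ^ 2 = 0 \<and>
        c ^ 3 * (of_nat q * (1 + (of_nat q - 1) * x)) ^ N = 1 \<and> (\<forall>i\<le>N. T $$ (i, i) = c * x ^ i)"
      using x tx unfolding t_def by blast
  next
    assume "\<exists>x c. 1 - 2 * x + of_nat q * x + x ^ 2 = 0 \<and>
        c ^ 3 * (of_nat q * (1 + (of_nat q - 1) * x)) ^ N = 1 \<and> (\<forall>i\<le>N. T $$ (i, i) = c * x ^ i)"
    then obtain x c where x: "1 - 2 * x + of_nat q * x + x ^ 2 = 0"
      and c: "c ^ 3 * (of_nat q * (1 + (of_nat q - 1) * x)) ^ N = 1"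
      and tx: "\<And>i. i \<le> N \<Longrightarrow> t i = c * x ^ i"
      unfolding t_def by blast
    have "(hamming_eigenmatrix N q * mat_diag (Suc N) t) ^\<^sub>m 3 =
        (c ^ 3 * (of_nat q * (1 + (of_nat q - 1) * x)) ^ N) \<cdot>\<^sub>m 1\<^sub>m (Suc N)"
      by (rule twisted_cube[OF x]) (rule tx)
    also have "\<dots> = 1\<^sub>m (Suc N)"
      using c scalar by metis
    finally have "(hamming_eigenmatrix N q * mat_diag (Suc N) t) ^\<^sub>m 3 = 1\<^sub>m (Suc N)" .
    then show "(hamming_eigenmatrix N q * T) ^\<^sub>m 3 = 1\<^sub>m (N + 1)"
      by (simp add: T)
  qed
qed

end
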